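(* There is a positive constant $C$ such that for all $n\ge 1$ we have $$|c_n|\le \frac{C}{n^{3/2}}.$$
   Context: Let $\mathcal H=L^2([0,1],dx)$ (complex-valued functions, Lebesgue measure) with its norm $\|\cdot\|$. The sequence $(c_n)_{n\ge 0}$ is defined recursively: $c_0=1$, and, writing $p_n(x)=c_0+c_1x+\ldots+c_nx^n$, for each $n\ge 0$ the number $c_{n+1}$ is the unique complex number $c$ for which the norm $\|p_n(x)+c\,x^{n+1}\|$ is minimal among all $c\in\mathbb C$. Equivalently, $c_0=1$ and $\frac{c_0}{n+1}+\frac{c_1}{n+2}+\ldots+\frac{c_n}{2n+1}=0$ for all $n\ge 1$. *)

theory Defs
  imports "HOL-Analysis.Analysis"
begin

definition L2_norm01 :: "(real \<Rightarrow> complex) \<Rightarrow> real" where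
  "L2_norm01 f = sqrt (LINT x:{0..1}|lborel. (cmod (f x))\<^sup>2)"

fun greedy_coeff :: "nat \<Rightarrow> complex" where
  "greedy_coeff 0 = 1"
| "greedy_coeff (Suc n) =
     (THE c. is_arg_min
        (\<lambda>d. L2_norm01 (\<lambda>x. (\<Sum>k\<le>n. greedy_coeff k * of_real x ^ k) + d * of_real x ^ Suc n))
        (\<lambda>_. True) c)"

text \<open>
  The description operator above is well defined: along any line in the direction of a monomial
  the norm has exactly one minimiser, characterised by orthogonality of the residual to that monomial.
\<close>

lemma L2_norm01_add_monomial:
  fixes a :: "nat \<Rightarrow> complex" and d :: complex and n :: nat
  defines "z \<equiv> - of_nat (2 * n + 3) * (\<Sum>k\<le>n. a k / of_nat (n + k + 2))"
  shows "(L2_norm01 (\<lambda>x. (\<Sum>k\<le>n. a k * of_real x ^ k) + d * of_real x ^ Suc n))\<^sup>2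
       = (L2_norm01 (\<lambda>x. (\<Sum>k\<le>n. a k * of_real x ^ k) + z * of_real x ^ Suc n))\<^sup>2
         + (cmod (d - z))\<^sup>2 / (2 * n + 3)"
proof -
  define p where "p d x = (\<Sum>k\<le>n. a k * of_real x ^ k) + d * of_real x ^ Suc n" for d and x :: real
  have cont: "continuous_on A (p d)" for A d
    unfolding p_def by (intro continuous_intros)
  have int: "set_integrable lborel {0..1} f" if "continuous_on {0..1} f" for f :: "real \<Rightarrow> 'b::euclidean_space"
    using borel_integrable_compact[OF _ that] by (simp add: set_integrable_def indicator_scaleR_eq_if)
  have sq: "(L2_norm01 (p d))\<^sup>2 = (LINT x:{0..1}|lborel. (cmod (p d x))\<^sup>2)" for d
    unfolding L2_norm01_def
    by (subst real_sqrt_pow2) (auto simp: set_lebesgue_integral_def intro!: Bochner_Integration.integral_nonneg)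
  have mono: "(LINT x:{0..1}|lborel. complex_of_real x ^ m) = 1 / of_nat (Suc m)" for m
  proof -
    have "(LINT x:{0..1}|lborel. x ^ m) = 1 / real (Suc m)"
      using integral_power[of 0 1 m] by (simp add: set_lebesgue_integral_def mult.commute)
    moreover have "(LINT x:{0..1}|lborel. complex_of_real (x ^ m)) = of_real (LINT x:{0..1}|lborel. x ^ m)"
      by (rule set_integral_complex_of_real)
    ultimately show ?thesis by simp
  qed
  have orth: "(LINT x:{0..1}|lborel. p z x * of_real x ^ Suc n) = 0"
  proof -
    have "(LINT x:{0..1}|lborel. p z x * of_real x ^ Suc n)
        = (LINT x:{0..1}|lborel. (\<Sum>k\<le>n. a k * of_real x ^ (n + k + 1)) + z * of_real x ^ (2 * n + 2))"
      unfolding p_def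
      by (rule set_lebesgue_integral_cong)
         (auto simp: algebra_simps sum_distrib_left sum_distrib_right power_add mult_2_right)
    also have "\<dots> = (LINT x:{0..1}|lborel. (\<Sum>k\<le>n. a k * of_real x ^ (n + k + 1)))
                  + (LINT x:{0..1}|lborel. z * of_real x ^ (2 * n + 2))"
      by (intro set_integral_add int continuous_intros)
    also have "(LINT x:{0..1}|lborel. z * of_real x ^ (2 * n + 2)) = z / of_nat (2 * n + 3)"
      by (subst set_integral_mult_right, subst mono) (simp add: numeral_3_eq_3)
    also have "(LINT x:{0..1}|lborel. (\<Sum>k\<le>n. a k * complex_of_real x ^ (n + k + 1)))
             = (\<Sum>k\<le>n. LINT x:{0..1}|lborel. a k * complex_of_real x ^ (n + k + 1))"
      unfolding set_lebesgue_integral_def scaleR_sum_right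
      by (intro Bochner_Integration.integral_sum int[unfolded set_integrable_def] continuous_intros)
    also have "\<dots> = (\<Sum>k\<le>n. a k / of_nat (n + k + 2))"
      by (intro sum.cong refl, subst set_integral_mult_right, subst mono) simp
    also have "z / of_nat (2 * n + 3) = - (\<Sum>k\<le>n. a k / of_nat (n + k + 2))"
    proof -
      have "(of_nat (2 * n + 3) :: complex) \<noteq> 0" unfolding of_nat_eq_0_iff by simp
      then show ?thesis unfolding z_def by (simp del: of_nat_add of_nat_mult)
    qed
    finally show ?thesis by simp
  qed
  have ptw: "(cmod (p d x))\<^sup>2 = (cmod (p z x))\<^sup>2
      + (2 * Re (cnj (d - z) * (p z x * of_real x ^ Suc n)) + (cmod (d - z))\<^sup>2 * x ^ (2 * n + 2))"
    if "x \<in> {0..1}" for x :: real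
  proof -
    have 1: "p d x = p z x + (d - z) * of_real (x ^ Suc n)"
      by (simp add: p_def algebra_simps)
    have 2: "(cmod (u + v * of_real t))\<^sup>2
        = (cmod u)\<^sup>2 + (2 * Re (cnj v * (u * of_real t)) + (cmod v)\<^sup>2 * t\<^sup>2)" for u v :: complex and t
      unfolding cmod_power2 by (simp add: algebra_simps power2_eq_square)
    have 3: "x ^ (2 * n + 2) = (x ^ Suc n)\<^sup>2"
      by (simp add: power_mult[symmetric] mult.commute flip: power_Suc)
    show ?thesis using 2[of "p z x" "d - z" "x ^ Suc n"] unfolding 1 3 of_real_power .
  qed
  have "(LINT x:{0..1}|lborel. (cmod (p d x))\<^sup>2)
      = (LINT x:{0..1}|lborel. (cmod (p z x))\<^sup>2
      + (2 * Re (cnj (d - z) * (p z x * of_real x ^ Suc n)) + (cmod (d - z))\<^sup>2 * x ^ (2 * n + 2)))"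
    by (rule set_lebesgue_integral_cong) (use ptw in auto)
  also have "\<dots> = (LINT x:{0..1}|lborel. (cmod (p z x))\<^sup>2)
      + ((LINT x:{0..1}|lborel. 2 * Re (cnj (d - z) * (p z x * of_real x ^ Suc n)))
      + (LINT x:{0..1}|lborel. (cmod (d - z))\<^sup>2 * x ^ (2 * n + 2)))"
    by (subst set_integral_add, (intro int continuous_intros cont)+,
        subst set_integral_add, (intro int continuous_intros cont)+, rule refl)
  also have "(LINT x:{0..1}|lborel. 2 * Re (cnj (d - z) * (p z x * of_real x ^ Suc n))) = 0"
  proof -
    have *: "set_integrable lborel {0..1} (\<lambda>x. cnj (d - z) * (p z x * of_real x ^ Suc n))"
      by (intro int continuous_intros cont)
    have "(LINT x:{0..1}|lborel. Re (cnj (d - z) * (p z x * of_real x ^ Suc n)))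
        = Re (LINT x:{0..1}|lborel. cnj (d - z) * (p z x * of_real x ^ Suc n))"
      using integral_Re[OF *[unfolded set_integrable_def]]
      unfolding set_lebesgue_integral_def by simp
    also have "\<dots> = 0" by (subst set_integral_mult_right, subst orth) simp
    finally show ?thesis by (subst set_integral_mult_right) simp
  qed
  also have "(LINT x:{0..1}|lborel. (cmod (d - z))\<^sup>2 * x ^ (2 * n + 2)) = (cmod (d - z))\<^sup>2 / (2 * n + 3)"
  proof -
    have "(LINT x:{0..1}|lborel. x ^ (2 * n + 2)) = 1 / real (2 * n + 3)"
      using integral_power[of 0 1 "2 * n + 2"]
      by (simp add: set_lebesgue_integral_def mult.commute numeral_eq_Suc)
    then show ?thesis by (subst set_integral_mult_right) simp
  qed
  finally have "(L2_norm01 (p d))\<^sup>2 = (L2_norm01 (p z))\<^sup>2 + (cmod (d - z))\<^sup>2 / (2 * n + 3)"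
    by (simp add: sq)
  then show ?thesis unfolding p_def .
qed

lemma is_arg_min_L2_norm01_iff:
  fixes a :: "nat \<Rightarrow> complex"
  shows "is_arg_min (\<lambda>d. L2_norm01 (\<lambda>x. (\<Sum>k\<le>n. a k * of_real x ^ k) + d * of_real x ^ Suc n)) (\<lambda>_. True) c
     \<longleftrightarrow> c = - of_nat (2 * n + 3) * (\<Sum>k\<le>n. a k / of_nat (n + k + 2))"
    (is "is_arg_min ?N _ c \<longleftrightarrow> c = ?z")
proof -
  have nn: "?N d \<ge> 0" for d
    unfolding L2_norm01_def set_lebesgue_integral_def
    by (auto intro!: Bochner_Integration.integral_nonneg)
  have sq: "s < t \<longleftrightarrow> s\<^sup>2 < t\<^sup>2" if "0 \<le> s" "0 \<le> t" for s t :: real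
    using power_strict_mono[of s t 2] power_less_imp_less_base[of s 2 t] that by auto
  have "?N d < ?N e \<longleftrightarrow> cmod (d - ?z) < cmod (e - ?z)" for d e
  proof -
    have "?N d < ?N e \<longleftrightarrow> (cmod (d - ?z))\<^sup>2 / (2 * n + 3) < (cmod (e - ?z))\<^sup>2 / (2 * n + 3)"
      using sq[OF nn[of d] nn[of e]]
        L2_norm01_add_monomial[where a = a and n = n and d = d]
        L2_norm01_add_monomial[where a = a and n = n and d = e] by linarith
    also have "\<dots> \<longleftrightarrow> (cmod (d - ?z))\<^sup>2 < (cmod (e - ?z))\<^sup>2"
      by (rule divide_less_cancel[THEN trans]) auto
    also have "\<dots> \<longleftrightarrow> cmod (d - ?z) < cmod (e - ?z)"
      using sq[OF norm_ge_zero norm_ge_zero, of "d - ?z" "e - ?z"] ..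
    finally show ?thesis .
  qed
  then have "is_arg_min ?N (\<lambda>_. True) c \<longleftrightarrow> (\<forall>d. \<not> cmod (d - ?z) < cmod (c - ?z))"
    unfolding is_arg_min_def by blast
  also have "\<dots> \<longleftrightarrow> c = ?z"
  proof
    assume "\<forall>d. \<not> cmod (d - ?z) < cmod (c - ?z)"
    then have "\<not> cmod (?z - ?z) < cmod (c - ?z)" ..
    then show "c = ?z" by (simp only: diff_self norm_zero zero_less_norm_iff right_minus_eq not_not)
  next
    assume "c = ?z"
    then show "\<forall>d. \<not> cmod (d - ?z) < cmod (c - ?z)"
      by (simp only: diff_self norm_zero norm_not_less_zero not_False_eq_True simp_thms)
  qed
  finally show ?thesis .
qed

lemma ex1_is_arg_min_L2_norm01:
  "\<exists>!c. is_arg_min (\<lambda>d. L2_norm01 (\<lambda>x. (\<Sum>k\<le>n. a k * of_real x ^ k) + d * of_real x ^ Suc n)) (\<lambda>_. True) c"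
  unfolding is_arg_min_L2_norm01_iff by simp

end

theory Submission
  imports Defs
begin

text \<open>
  The sequence \<open>b n = n * c n\<close> is square summable. Subtracting a multiple of the
  orthogonality relation for \<open>n - 1\<close> from the one for \<open>n\<close>, so as to cancel \<open>c 0\<close>, gives
  \<open>(n + 1) / (2 * n + 1) * b n + (\<Sum>k=1..<n. n * b k / ((n + k) * (n + k + 1))) = 0\<close> for \<open>n \<ge> 2\<close>.
  Multiplying by \<open>b n\<close> and summing turns the left-hand side into a quadratic form with kernel
  \<open>max n k / ((n + k) * (n + k + 1)) = 1 / (n + k + 1) - min n k / ((n + k) * (n + k + 1))\<close>
  next to a diagonal part of size \<open>1 / 2\<close>. The Hilbert kernel is positive, and the rows of the
  subtracted kernel sum to at most \<open>3 / 4\<close>, so by the Schur test the form is coercive.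
  Cauchy-Schwarz applied to the recursion for \<open>b n\<close> then gives the pointwise decay.
\<close>

text \<open>Since \<open>1 / (i + j + 1)\<close> is the integral of \<open>x ^ (i + j)\<close> over
  the unit interval, the form is the integral of the square of the polynomial with coefficients
  \<open>b i\<close>.\<close>

lemma Hilbert_form_nonneg:
  fixes b :: "nat \<Rightarrow> real"
  assumes "finite A"
  shows "0 \<le> (\<Sum>i\<in>A. \<Sum>j\<in>A. b i * b j / real (i + j + 1))"
proof -
  have "((\<lambda>x. x ^ n) has_integral 1 / real (n + 1)) {0..1}" for n
  proof -
    have "((\<lambda>x. x ^ n) has_integral (1 ^ (n + 1) / real (n + 1) - 0 ^ (n + 1) / real (n + 1))) {0..1}"
      using DERIV_cdivide[OF DERIV_pow[of "n + 1"], where c = "real (n + 1)"]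
      by (intro fundamental_theorem_of_calculus)
         (simp_all del: of_nat_Suc flip: has_real_derivative_iff_has_vector_derivative)
    then show ?thesis by simp
  qed
  then have "((\<lambda>x. b i * b j * x ^ (i + j)) has_integral b i * b j * (1 / real (i + j + 1))) {0..1}" for i j
    by (rule has_integral_mult_right)
  then have "((\<lambda>x. \<Sum>i\<in>A. \<Sum>j\<in>A. b i * b j * x ^ (i + j)) has_integral
      (\<Sum>i\<in>A. \<Sum>j\<in>A. b i * b j * (1 / real (i + j + 1)))) {0..1}"
    using assms by (intro has_integral_sum)
  moreover have "(\<Sum>i\<in>A. \<Sum>j\<in>A. b i * b j * x ^ (i + j)) = (\<Sum>i\<in>A. b i * x ^ i)\<^sup>2" for x
    by (simp add: power2_eq_square sum_product power_add mult_ac)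
  ultimately show ?thesis
    by (auto intro: has_integral_nonneg)
qed

text \<open>Bridges the recursion, which only sees \<open>k < n\<close>, and the kernel estimates,
  which concern the full square of indices.\<close>

lemma sum_symmetric_square:
  fixes f :: "nat \<Rightarrow> nat \<Rightarrow> 'a::comm_semiring_1"
  assumes "\<And>i j. f i j = f j i"
  shows "(\<Sum>i=1..N. \<Sum>j=1..N. f i j) = (\<Sum>i=1..N. f i i) + 2 * (\<Sum>i=1..N. \<Sum>j=1..<i. f i j)"
proof (induction N)
  case (Suc N)
  have "(\<Sum>i=1..N. f i (Suc N)) = (\<Sum>j=1..N. f (Suc N) j)"
    using assms by (intro sum.cong) auto
  moreover have "{1..<Suc N} = {1..N}" by auto
  ultimately show ?case
    using Suc by (simp add: sum.distrib mult_2 add_ac)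
qed simp

text \<open>Bounding \<open>b i * b j\<close> by
  \<open>(b i)\<^sup>2 / 2 + (b j)\<^sup>2 / 2\<close> leaves two sums that symmetry makes equal,
  each being half the row sums weighted by \<open>(b i)\<^sup>2\<close>.\<close>

lemma Schur_test_symmetric:
  fixes K :: "'a \<Rightarrow> 'a \<Rightarrow> real"
  assumes "\<And>i j. K i j = K j i" and "\<And>i j. 0 \<le> K i j"
    and row: "\<And>i. i \<in> A \<Longrightarrow> (\<Sum>j\<in>A. K i j) \<le> r"
  shows "(\<Sum>i\<in>A. \<Sum>j\<in>A. K i j * (b i * b j)) \<le> r * (\<Sum>i\<in>A. (b i)\<^sup>2)"
proof -
  have "(\<Sum>i\<in>A. \<Sum>j\<in>A. K i j * (b i * b j))
      \<le> (\<Sum>i\<in>A. \<Sum>j\<in>A. K i j * ((b i)\<^sup>2 / 2) + K i j * ((b j)\<^sup>2 / 2))"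
  proof (intro sum_mono)
    fix i j
    have "b i * b j \<le> (b i)\<^sup>2 / 2 + (b j)\<^sup>2 / 2"
      using sum_squares_bound[of "b i" "b j"] by simp
    from mult_left_mono[OF this assms(2)]
    show "K i j * (b i * b j) \<le> K i j * ((b i)\<^sup>2 / 2) + K i j * ((b j)\<^sup>2 / 2)"
      by (simp only: distrib_left)
  qed
  also have "\<dots> = (\<Sum>i\<in>A. \<Sum>j\<in>A. K i j * ((b i)\<^sup>2 / 2)) + (\<Sum>j\<in>A. \<Sum>i\<in>A. K j i * ((b j)\<^sup>2 / 2))"
    unfolding sum.distrib
    by (subst (2) sum.swap, intro arg_cong2[where f = plus] sum.cong refl) (simp add: assms(1))
  also have "\<dots> = (\<Sum>i\<in>A. (\<Sum>j\<in>A. K i j) * (b i)\<^sup>2)"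
    by (simp add: sum_distrib_right flip: sum_divide_distrib)
  also have "\<dots> \<le> (\<Sum>i\<in>A. r * (b i)\<^sup>2)"
    by (intro sum_mono mult_right_mono row) auto
  finally show ?thesis by (simp add: sum_distrib_left)
qed

text \<open>The row is split at \<open>k = n\<close>. The part \<open>k \<ge> n\<close> telescopes
  to at most \<open>n / (2 * n)\<close>; the fewer than \<open>n\<close> terms with
  \<open>k < n\<close> are each at most \<open>1 / (4 * n)\<close>, because
  \<open>4 * n * k \<le> (n + k)\<^sup>2\<close>.\<close>

lemma min_kernel_row_sum:
  assumes "1 \<le> n" "n \<le> N"
  shows "(\<Sum>k=1..N. real (min n k) / (real (n + k) * real (n + k + 1))) \<le> 3 / 4"
proof -
  have "{1..N} = {1..<n} \<union> {n..N}" using assms by auto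
  then have "(\<Sum>k=1..N. real (min n k) / (real (n + k) * real (n + k + 1)))
      = (\<Sum>k=1..<n. real (min n k) / (real (n + k) * real (n + k + 1)))
      + (\<Sum>k=n..N. real (min n k) / (real (n + k) * real (n + k + 1)))"
    by (simp only:) (rule sum.union_disjoint, auto)
  also have "(\<Sum>k=n..N. real (min n k) / (real (n + k) * real (n + k + 1))) \<le> 1 / 2"
  proof -
    have "(\<Sum>k=n..N. real (min n k) / (real (n + k) * real (n + k + 1)))
        = (\<Sum>k=n..N. real n / real (n + k) - real n / real (n + Suc k))"
      using assms by (intro sum.cong) (auto simp: field_simps)
    also have "\<dots> = real n / real (n + n) - real n / real (n + Suc N)"
      using sum_Suc_diff[of n N "\<lambda>k. - real n / real (n + k)"] assms by simp
    also have "\<dots> \<le> 1 / 2" using assms by simp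
    finally show ?thesis .
  qed
  also have "(\<Sum>k=1..<n. real (min n k) / (real (n + k) * real (n + k + 1))) \<le> (\<Sum>k=1..<n. 1 / (4 * real n))"
  proof (intro sum_mono)
    fix k assume k: "k \<in> {1..<n}"
    have "4 * real n * real k \<le> real (n + k) * real (n + k)"
      using zero_le_square[of "real n - real k"] by (simp add: algebra_simps)
    also have "\<dots> \<le> real (n + k) * real (n + k + 1)"
      by (intro mult_left_mono) auto
    finally show "real (min n k) / (real (n + k) * real (n + k + 1)) \<le> 1 / (4 * real n)"
      using k assms by (simp add: divide_simps mult_ac)
  qed
  also have "(\<Sum>k=1..<n. 1 / (4 * real n)) \<le> 1 / 4"
    using assms by (simp add: field_simps)
  finally show ?thesis by simp
qed

text \<open>Up to a nonnegative diagonal remainder, the right-hand side is half the sum of squares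
  plus half the full form with kernel \<open>max\<close>. The full form is at least
  \<open>- 3 / 4\<close> times the sum of squares, so \<open>1 / 2 - 3 / 8 = 1 / 8\<close>
  survives.\<close>

lemma coercive_form:
  fixes b :: "nat \<Rightarrow> real"
  shows "(\<Sum>n=1..N. (b n)\<^sup>2) / 8 \<le> (\<Sum>n=1..N. b n * (real (n + 1) / real (2 * n + 1) * b n
      + (\<Sum>k=1..<n. real n * b k / (real (n + k) * real (n + k + 1)))))"
proof -
  define M where "M i j = real (max i j) / (real (i + j) * real (i + j + 1)) * (b i * b j)" for i j
  define m where "m i j = real (min i j) / (real (i + j) * real (i + j + 1))" for i j
  have "(\<Sum>i=1..N. \<Sum>j=1..N. m i j * (b i * b j)) \<le> 3 / 4 * (\<Sum>i=1..N. (b i)\<^sup>2)"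
  proof (rule Schur_test_symmetric)
    fix i j show "m i j = m j i"
      by (simp only: m_def min.commute add.commute)
  next
    fix i assume "i \<in> {1..N}"
    then show "(\<Sum>j=1..N. m i j) \<le> 3 / 4"
      unfolding m_def by (intro min_kernel_row_sum) auto
  qed (simp add: m_def)
  \<comment> \<open>Here \<open>i \<ge> 1\<close> matters: at \<open>i = j = 0\<close> division by
    zero turns \<open>M\<close> and \<open>m\<close> into 0, while the Hilbert kernel is 1.\<close>
  moreover have "M i j = b i * b j / real (i + j + 1) - m i j * (b i * b j)" if "i \<in> {1..N}" for i j
  proof -
    have "(s - t) / (s * (s + 1)) * x = x / (s + 1) - t / (s * (s + 1)) * x" if "0 < s" for s t x :: real
      using that by (simp add: divide_simps) (simp add: algebra_simps)
    moreover have "real (max i j) = real (i + j) - real (min i j)" by simp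
    moreover have "real (i + j + 1) = real (i + j) + 1" "0 < real (i + j)" using that by simp_all
    ultimately show ?thesis unfolding M_def m_def by metis
  qed
  then have "(\<Sum>i=1..N. \<Sum>j=1..N. M i j)
      = (\<Sum>i=1..N. \<Sum>j=1..N. b i * b j / real (i + j + 1)) - (\<Sum>i=1..N. \<Sum>j=1..N. m i j * (b i * b j))"
    by (simp flip: sum_subtractf)
  moreover have "0 \<le> (\<Sum>i=1..N. \<Sum>j=1..N. b i * b j / real (i + j + 1))"
    by (rule Hilbert_form_nonneg) simp
  moreover have "(\<Sum>i=1..N. \<Sum>j=1..N. M i j)
      = (\<Sum>i=1..N. M i i) + 2 * (\<Sum>i=1..N. \<Sum>j=1..<i. M i j)"
    by (rule sum_symmetric_square) (simp only: M_def max.commute add.commute mult.commute)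
  ultimately have "(\<Sum>n=1..N. (b n)\<^sup>2) / 8
      \<le> (\<Sum>n=1..N. (b n)\<^sup>2) / 2 + (\<Sum>n=1..N. M n n) / 2 + (\<Sum>n=1..N. \<Sum>k=1..<n. M n k)"
    by simp
  also have "\<dots> = (\<Sum>n=1..N. (b n)\<^sup>2 / 2 + M n n / 2 + (\<Sum>k=1..<n. M n k))"
    by (simp add: sum.distrib sum_divide_distrib)
  also have "\<dots> \<le> (\<Sum>n=1..N. b n * (real (n + 1) / real (2 * n + 1) * b n
      + (\<Sum>k=1..<n. real n * b k / (real (n + k) * real (n + k + 1)))))"
  proof (rule sum_mono)
    fix n assume "n \<in> {1..N}"
    have half_le: "x / 2 \<le> x" if "0 \<le> x" for x :: real using that by simp
    from \<open>n \<in> {1..N}\<close> have "real n > 0" by simp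
    then have "M n n = (b n)\<^sup>2 / real (2 * n + 1) / 2"
      by (simp add: M_def power2_eq_square divide_simps)
    then have le: "M n n \<le> (b n)\<^sup>2 / real (2 * n + 1)"
      using half_le divide_nonneg_nonneg[OF zero_le_power2 of_nat_0_le_iff] by metis
    \<comment> \<open>The diagonal coefficient exceeds \<open>1 / 2\<close> by
      \<open>1 / (2 * (2 * n + 1))\<close>, which is enough to absorb
      \<open>M n n / 2\<close>.\<close>
    have diag: "(b n)\<^sup>2 / 2 + (b n)\<^sup>2 / real (2 * n + 1) / 2 = b n * (real (n + 1) / real (2 * n + 1) * b n)"
      by (simp add: divide_simps power2_eq_square) (simp add: algebra_simps)
    have off_diag: "(\<Sum>k=1..<n. M n k) = b n * (\<Sum>k=1..<n. real n * b k / (real (n + k) * real (n + k + 1)))"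
      unfolding sum_distrib_left by (intro sum.cong) (auto simp: M_def)
    show "(b n)\<^sup>2 / 2 + M n n / 2 + (\<Sum>k=1..<n. M n k) \<le> b n * (real (n + 1) / real (2 * n + 1) * b n
      + (\<Sum>k=1..<n. real n * b k / (real (n + k) * real (n + k + 1))))"
      unfolding distrib_left off_diag diag[symmetric]
      using le by (intro add_right_mono add_left_mono divide_right_mono) auto
  qed
  finally show ?thesis .
qed

text \<open>In \<open>n + 1\<close> times the relation for \<open>n\<close> minus \<open>n\<close>
  times the relation for \<open>n - 1\<close>, the weight of \<open>c k\<close> becomes
  \<open>k / ((n + k) * (n + k + 1))\<close> for \<open>k < n\<close>, which vanishes at
  \<open>k = 0\<close>. Using the relation for \<open>n - 1\<close> forces
  \<open>n \<ge> 2\<close>.\<close>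

lemma orthogonality_recursion:
  fixes c :: "nat \<Rightarrow> real"
  assumes orth: "\<And>n. 1 \<le> n \<Longrightarrow> (\<Sum>k\<le>n. c k / real (n + k + 1)) = 0" and "2 \<le> n"
  shows "real (n + 1) / real (2 * n + 1) * c n
    + (\<Sum>k=1..<n. real k * c k / (real (n + k) * real (n + k + 1))) = 0"
proof -
  obtain l where n: "n = Suc l" and "1 \<le> l" using \<open>2 \<le> n\<close> by (cases n) auto
  have "(\<Sum>k<n. c k / real (n + k)) = 0"
    using orth[OF \<open>1 \<le> l\<close>] by (simp add: n lessThan_Suc_atMost)
  moreover have "(\<Sum>k<n. c k / real (n + k + 1)) + c n / real (2 * n + 1) = 0"
    using orth[of n] \<open>2 \<le> n\<close>
    unfolding lessThan_Suc_atMost[symmetric] sum.lessThan_Suc mult_2 by linarith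
  moreover have "real k * c k / (real (n + k) * real (n + k + 1))
      = real (n + 1) * (c k / real (n + k + 1)) - real n * (c k / real (n + k))" for k
  proof -
    have "y * z / ((x + y) * (x + y + 1)) = (x + 1) * (z / (x + y + 1)) - x * (z / (x + y))"
      if "0 < x" "0 \<le> y" for x y z :: real
    proof -
      have "x + y \<noteq> 0" "x + y + 1 \<noteq> 0" using that by linarith+
      then show ?thesis by (simp add: divide_simps) (simp add: algebra_simps)
    qed
    from this[of "real n" "real k" "c k"] show ?thesis
      using \<open>2 \<le> n\<close> by (simp add: add_ac)
  qed
  then have "(\<Sum>k<n. real k * c k / (real (n + k) * real (n + k + 1)))
      = real (n + 1) * (\<Sum>k<n. c k / real (n + k + 1)) - real n * (\<Sum>k<n. c k / real (n + k))"
    by (simp only: sum_subtractf sum_distrib_left)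
  moreover have "(\<Sum>k=1..<n. real k * c k / (real (n + k) * real (n + k + 1)))
      = (\<Sum>k<n. real k * c k / (real (n + k) * real (n + k + 1)))"
    by (rule sum.mono_neutral_left) auto
  moreover have "p / d * z + p * S = p * (S + z / d)" for p d z S :: real
    by (simp add: distrib_left)
  ultimately show ?thesis
    by (simp only: mult_zero_right diff_zero)
qed

text \<open>The recursion kills every summand of the form for \<open>b n = n * c n\<close> except
  the one at \<open>n = 1\<close>, which equals \<open>2 / 3 * (c 1)\<^sup>2\<close>. Coercivity
  then costs a factor 8, rounded up to the perfect square 9.\<close>

lemma weighted_square_sum_bound:
  fixes c :: "nat \<Rightarrow> real"
  assumes orth: "\<And>n. 1 \<le> n \<Longrightarrow> (\<Sum>k\<le>n. c k / real (n + k + 1)) = 0"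
  shows "(\<Sum>n=1..N. (real n * c n)\<^sup>2) \<le> (3 * c 1)\<^sup>2"
proof -
  define R where "R n = real n * c n * (real (n + 1) / real (2 * n + 1) * (real n * c n)
      + (\<Sum>k=1..<n. real n * (real k * c k) / (real (n + k) * real (n + k + 1))))" for n
  have "R n = 0" if "n \<noteq> 1" for n
  proof (cases "n = 0")
    case False
    with that have "2 \<le> n" by simp
    have "R n = real n * c n * (real n * (real (n + 1) / real (2 * n + 1) * c n
      + (\<Sum>k=1..<n. real k * c k / (real (n + k) * real (n + k + 1)))))"
      by (simp add: R_def distrib_left sum_distrib_left mult_ac)
    then show ?thesis using orthogonality_recursion[OF orth \<open>2 \<le> n\<close>] by simp
  qed (simp add: R_def)
  \<comment> \<open>The intersection is empty for \<open>N = 0\<close>, so this case needs no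
    separate treatment.\<close>
  then have "(\<Sum>n=1..N. R n) = (\<Sum>n\<in>{1..N} \<inter> {1}. R n)"
    by (intro sum.mono_neutral_right) auto
  also have "\<dots> \<le> R 1"
    by (cases "N = 0") (auto simp: R_def)
  also have "R 1 \<le> (c 1)\<^sup>2"
    by (simp add: R_def power2_eq_square)
  finally have "(\<Sum>n=1..N. R n) \<le> (c 1)\<^sup>2" .
  moreover have "(\<Sum>n=1..N. (real n * c n)\<^sup>2) / 8 \<le> (\<Sum>n=1..N. R n)"
    using coercive_form[where b = "\<lambda>n. real n * c n" and N = N] unfolding R_def .
  moreover have "(3 * c 1)\<^sup>2 = 9 * (c 1)\<^sup>2" by (simp add: power_mult_distrib)
  ultimately show ?thesis using zero_le_power2[of "c 1"] by linarith
qed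

text \<open>The kernel of the recursion is at most \<open>1 / n\<^sup>2\<close>, and Cauchy-Schwarz
  bounds the sum of \<open>\<bar>k * c k\<bar>\<close> by
  \<open>3 * \<bar>c 1\<bar> * sqrt n\<close>. The factor
  \<open>(2 * n + 1) / (n + 1) \<le> 2\<close> raises the constant to 6.\<close>

lemma orthogonal_coeff_bound:
  fixes c :: "nat \<Rightarrow> real"
  assumes orth: "\<And>n. 1 \<le> n \<Longrightarrow> (\<Sum>k\<le>n. c k / real (n + k + 1)) = 0" and "1 \<le> n"
  shows "\<bar>c n\<bar> \<le> 6 * \<bar>c 1\<bar> / real n powr (3/2)"
proof (cases "n = 1")
  case False
  with \<open>1 \<le> n\<close> have "2 \<le> n" by simp
  define S where "S = (\<Sum>k=1..<n. real k * c k / (real (n + k) * real (n + k + 1)))"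
  have "c n = - (real (2 * n + 1) / real (n + 1)) * S"
    using orthogonality_recursion[OF orth \<open>2 \<le> n\<close>] unfolding S_def[symmetric] by (simp add: field_simps)
  then have "\<bar>c n\<bar> = real (2 * n + 1) / real (n + 1) * \<bar>S\<bar>"
    by (simp add: abs_mult)
  also have "\<dots> \<le> 2 * \<bar>S\<bar>"
    by (intro mult_right_mono) (auto simp: field_simps)
  \<comment> \<open>The factor 1 is the second vector in the Cauchy-Schwarz inequality
    below.\<close>
  also have "\<bar>S\<bar> \<le> (\<Sum>k=1..<n. \<bar>real k * c k\<bar> * 1) / (real n)\<^sup>2"
  proof -
    have "\<bar>S\<bar> \<le> (\<Sum>k=1..<n. \<bar>real k * c k\<bar> / (real (n + k) * real (n + k + 1)))"
      unfolding S_def by (rule order_trans[OF sum_abs]) (simp add: abs_mult)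
    also have "\<dots> \<le> (\<Sum>k=1..<n. \<bar>real k * c k\<bar> / (real n)\<^sup>2)"
      using \<open>2 \<le> n\<close> unfolding power2_eq_square
      by (intro sum_mono divide_left_mono mult_mono) auto
    finally show ?thesis by (simp add: sum_divide_distrib)
  qed
  also have "(\<Sum>k=1..<n. \<bar>real k * c k\<bar> * 1) \<le> sqrt (\<Sum>k=1..<n. (real k * c k)\<^sup>2) * sqrt (\<Sum>k=1..<n. 1\<^sup>2)"
    using L2_set_mult_ineq[of "\<lambda>k. real k * c k" "\<lambda>_. 1" "{1..<n}"] by (simp add: L2_set_def)
  also have "\<dots> \<le> (3 * \<bar>c 1\<bar>) * sqrt (real n)"
  proof (intro mult_mono)
    have "{1..<n} = {1..n - 1}" using \<open>2 \<le> n\<close> by auto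
    then have "sqrt (\<Sum>k=1..<n. (real k * c k)\<^sup>2) \<le> sqrt ((3 * c 1)\<^sup>2)"
      using weighted_square_sum_bound[OF orth, of "n - 1"] by (intro real_sqrt_le_mono) (simp only:)
    also have "sqrt ((3 * c 1)\<^sup>2) = 3 * \<bar>c 1\<bar>"
      unfolding real_sqrt_abs by (simp add: abs_mult)
    finally show "sqrt (\<Sum>k=1..<n. (real k * c k)\<^sup>2) \<le> 3 * \<bar>c 1\<bar>" .
  qed (auto simp: sum_nonneg)
  also have "2 * ((3 * \<bar>c 1\<bar>) * sqrt (real n) / (real n)\<^sup>2) = 6 * \<bar>c 1\<bar> / real n powr (3/2)"
  proof -
    have "(real n)\<^sup>2 = sqrt (real n) * real n powr (3/2)"
      using powr_add[of "real n" "1 / 2" "3 / 2"] \<open>2 \<le> n\<close> by (simp add: powr_half_sqrt)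
    then show ?thesis using \<open>2 \<le> n\<close> by simp
  qed
  finally show ?thesis
    by (simp add: divide_right_mono)
qed simp

text \<open>The explicit minimiser is minus the inner product with \<open>x ^ n\<close> divided by
  the squared norm \<open>1 / (2 * n + 1)\<close> of that monomial; clearing this factor gives the
  relation.\<close>

lemma greedy_coeff_orthogonality:
  assumes "1 \<le> n"
  shows "(\<Sum>k\<le>n. greedy_coeff k / of_nat (n + k + 1)) = 0"
proof -
  obtain m where n: "n = Suc m" using assms by (cases n) auto
  have "greedy_coeff n = - of_nat (2 * m + 3) * (\<Sum>k\<le>m. greedy_coeff k / of_nat (m + k + 2))"
    unfolding n greedy_coeff.simps is_arg_min_L2_norm01_iff by (rule the_equality) auto
  moreover have "complex_of_nat (2 * m + 3) \<noteq> 0"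
    unfolding of_nat_eq_0_iff by simp
  moreover have "n + n + 1 = 2 * m + 3" "\<And>k. n + k + 1 = m + k + 2"
    by (auto simp: n)
  ultimately show ?thesis
    unfolding n sum.atMost_Suc by (simp only: n) (simp del: of_nat_add of_nat_mult)
qed

theorem theorem1:
  "\<exists>C::real. C > 0 \<and> (\<forall>n::nat. n \<ge> 1 \<longrightarrow> cmod (greedy_coeff n) \<le> C / real n powr (3/2))"
proof -
  \<comment> \<open>The relations have real coefficients, so the real and imaginary parts satisfy
    them separately and the real bound applies to each.\<close>
  define C where "C = 6 * \<bar>Re (greedy_coeff 1)\<bar> + 6 * \<bar>Im (greedy_coeff 1)\<bar>"
  \<comment> \<open>Adding 1 makes the constant positive without computing
    \<open>greedy_coeff 1\<close>.\<close>
  have "cmod (greedy_coeff n) \<le> (C + 1) / real n powr (3/2)" if "1 \<le> n" for n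
  proof -
    have "(\<Sum>k\<le>m. Re (greedy_coeff k) / real (m + k + 1)) = 0" if "1 \<le> m" for m
      using arg_cong[OF greedy_coeff_orthogonality[OF that], of Re] 
      by (simp only: Re_sum Re_divide_of_nat zero_complex.sel)
    then have "\<bar>Re (greedy_coeff n)\<bar> \<le> 6 * \<bar>Re (greedy_coeff 1)\<bar> / real n powr (3/2)"
      using that by (rule orthogonal_coeff_bound)
    moreover have "(\<Sum>k\<le>m. Im (greedy_coeff k) / real (m + k + 1)) = 0" if "1 \<le> m" for m
      using arg_cong[OF greedy_coeff_orthogonality[OF that], of Im]
      by (simp only: Im_sum Im_divide_of_nat zero_complex.sel)
    then have "\<bar>Im (greedy_coeff n)\<bar> \<le> 6 * \<bar>Im (greedy_coeff 1)\<bar> / real n powr (3/2)"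
      using that by (rule orthogonal_coeff_bound)
    ultimately have "cmod (greedy_coeff n) \<le> C / real n powr (3/2)"
      using cmod_le[of "greedy_coeff n"] by (simp add: C_def add_divide_distrib)
    then show ?thesis
      by (simp add: add_divide_distrib add_increasing2)
  qed
  moreover have "C + 1 > 0" by (simp add: C_def add_nonneg_pos)
  ultimately show ?thesis by blast
qed

end
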